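(* Suppose that $H$ is a quasitriangular Hopf $*$-algebra with universal R-matrix $\mathcal R$. Let $\psi$ be the braiding on the category $\mathbf{HMod}$ of left $H$-modules given by $\psi_{UV}=\tau\circ\mathcal R:U\otimes V\to V\otimes U$, and let $\overline\psi$ be its conjugate braiding. (a) If $\mathcal R$ is real, then $\overline\psi=\psi$, i.e. for any $U,V\in\mathbf{HMod}$ we have $\overline\psi_{UV}=\psi_{UV}$. (b) If $\mathcal R$ is inverse real, then $\overline\psi=\psi^{-1}$, i.e. for any $U,V\in\mathbf{HMod}$ we have $\overline\psi_{UV}=\psi_{VU}^{-1}$.
   Context: All vector spaces are over $\mathbb{C}$. A Hopf $*$-algebra is a Hopf algebra $H$ over $\mathbb{C}$ (coproduct $\Delta(a)=a_{(1)}\otimes a_{(2)}$, counit $\varepsilon$, antipode $S$) equipped with an antilinear map $*:H\to H$ such that $(a^* )^*=a$, $(ab)^*=b^*a^*$ and $\Delta(a^* )=a_{(1)}^*\otimes a_{(2)}^*$. Tensor products of modules carry the action $a\rhd(v\otimes w)=(a_{(1)}\rhd v)\otimes(a_{(2)}\rhd w)$. $H$ is quasitriangular with universal R-matrix $\mathcal R$ if $\mathcal R\in H\otimes H$ is invertible, $\mathcal R\Delta(a)\mathcal R^{-1}=\tau(\Delta(a))$ for all $a\in H$, where $\tau$ is the tensor flip, and $(\Delta\otimes\mathrm{id})(\mathcal R)=\mathcal R_{13}\mathcal R_{23}$, $(\mathrm{id}\otimes\Delta)(\mathcal R)=\mathcal R_{13}\mathcal R_{12}$ (leg-numbering notation).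 $\mathcal R$ acts coordinate-wise on $U\otimes V$. Write $\mathcal R_{21}=\tau(\mathcal R)$ and extend $*$ to $H\otimes H$ by $(a\otimes b)^*=a^*\otimes b^*$. $\mathcal R$ is real if $\mathcal R^*=\mathcal R_{21}$, and inverse real if $\mathcal R^*=\mathcal R^{-1}$. For a vector space $V$, the complex conjugate vector space $\overline{V}$ consists of formal symbols $\bar v$ ($v\in V$) with $\bar v+\bar w=\overline{v+w}$ and $\lambda\cdot\bar v=\overline{\bar\lambda v}$. For a linear map $T:V\to W$, $\overline T(\bar v)=\overline{T(v)}$. If $V$ is a left $H$-module, $\overline V$ is a left $H$-module via $a\rhd\bar v=\overline{S(a)^*\rhd v}$. Let $\sigma_V:\overline{\overline V}\to V$, $\bar{\bar v}\mapsto v$, and $\rho_{VW}:\overline{V\otimes W}\to\overline W\otimes\overline V$, $\overline{v\otimes w}\mapsto\bar w\otimes\bar v$; these are isomorphisms of modules. Conjugate braiding: let $\xi_{XY}=\rho_{XY}\circ\overline{\psi_{YX}}\circ\rho_{YX}^{-1}:\overline X\otimes\overline Y\to\overline Y\otimes\overline X$, where $\overline{\psi_{YX}}:\overline{Y\otimes X}\to\overline{X\otimes Y}$ is the complex conjugate of the map $\psi_{YX}$. Then $\overline\psi_{XY}=(\sigma_Y\otimes\sigma_X)\circ\xi_{\overline X\,\overline Y}\circ(\sigma_X^{-1}\otimes\sigma_Y^{-1}):X\otimes Y\to Y\otimes X$. *)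

theory Defs
  imports Complex_Main "HOL-Library.Poly_Mapping"
begin

section \<open>Complex vector spaces and algebras\<close>

class complex_vector = ab_group_add +
  fixes scaleC :: "complex \<Rightarrow> 'a \<Rightarrow> 'a" (infixr \<open>*\<^sub>C\<close> 75)
  assumes scaleC_add_right: "a *\<^sub>C (x + y) = a *\<^sub>C x + a *\<^sub>C y"
    and scaleC_add_left: "(a + b) *\<^sub>C x = a *\<^sub>C x + b *\<^sub>C x"
    and scaleC_scaleC: "a *\<^sub>C b *\<^sub>C x = (a * b) *\<^sub>C x"
    and scaleC_one: "1 *\<^sub>C x = x"

global_interpretation complex_vector: vector_space "scaleC :: complex \<Rightarrow> 'a \<Rightarrow> 'a::complex_vector"
  by unfold_locales (auto simp: scaleC_add_right scaleC_add_left scaleC_scaleC scaleC_one)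

(* Associative unital algebras. The zero algebra is not excluded (ring_1 would require 0 \<noteq> 1). *)
class complex_algebra_1 = complex_vector + ring + monoid_mult +
  assumes mult_scaleC_left: "(c *\<^sub>C x) * y = c *\<^sub>C (x * y)"
    and mult_scaleC_right: "x * (c *\<^sub>C y) = c *\<^sub>C (x * y)"

instantiation complex :: complex_algebra_1
begin
definition scaleC_complex :: "complex \<Rightarrow> complex \<Rightarrow> complex"
  where "scaleC_complex c x = c * x"
instance
  by standard (auto simp: scaleC_complex_def algebra_simps)
end

abbreviation clinear :: "('a::complex_vector \<Rightarrow> 'b::complex_vector) \<Rightarrow> bool"
  where "clinear \<equiv> Vector_Spaces.linear scaleC scaleC"

definition cbilinear :: "('a::complex_vector \<Rightarrow> 'b::complex_vector \<Rightarrow> 'c::complex_vector) \<Rightarrow> bool"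
  where "cbilinear f \<longleftrightarrow> (\<forall>a. clinear (f a)) \<and> (\<forall>b. clinear (\<lambda>a. f a b))"

definition antilinear :: "('a::complex_vector \<Rightarrow> 'b::complex_vector) \<Rightarrow> bool"
  where "antilinear f \<longleftrightarrow> (\<forall>x y. f (x + y) = f x + f y) \<and> (\<forall>c x. f (c *\<^sub>C x) = cnj c *\<^sub>C f x)"

lemma clinearI:
  assumes "\<And>x y. f (x + y) = f x + f y" "\<And>c x. f (c *\<^sub>C x) = c *\<^sub>C f x"
  shows "clinear f"
  by unfold_locales (auto simp: assms)

lemma clinear_add: "clinear f \<Longrightarrow> f (x + y) = f x + f y"
  by (rule Vector_Spaces.linear.axioms(3)[THEN module_hom.add])

lemma clinear_scale: "clinear f \<Longrightarrow> f (c *\<^sub>C x) = c *\<^sub>C f x"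
  by (rule Vector_Spaces.linear.axioms(3)[THEN module_hom.scale])

lemma clinear_diff: "clinear f \<Longrightarrow> f (x - y) = f x - f y"
  by (rule Vector_Spaces.linear.axioms(3)[THEN module_hom.diff])

lemma clinear_0: "clinear f \<Longrightarrow> f 0 = 0"
  by (rule Vector_Spaces.linear.axioms(3)[THEN module_hom.zero])

lemma cbilinearI:
  assumes "\<And>a x y. f a (x + y) = f a x + f a y" "\<And>a c x. f a (c *\<^sub>C x) = c *\<^sub>C f a x"
    "\<And>a x y. f (x + y) a = f x a + f y a" "\<And>a c x. f (c *\<^sub>C x) a = c *\<^sub>C f x a"
  shows "cbilinear f"
  unfolding cbilinear_def by (auto intro!: clinearI simp: assms)

lemma cbilinearD:
  assumes "cbilinear f"
  shows "f a (x + y) = f a x + f a y" "f a (c *\<^sub>C x) = c *\<^sub>C f a x"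
    "f (x' + y') b = f x' b + f y' b" "f (c *\<^sub>C x') b = c *\<^sub>C f x' b"
  using assms clinear_add[of "f a"] clinear_add[of "\<lambda>a. f a b"]
    clinear_scale[of "f a"] clinear_scale[of "\<lambda>a. f a b"]
  unfolding cbilinear_def by auto


section \<open>The algebraic tensor product\<close>

instantiation poly_mapping :: (type, complex_vector) complex_vector
begin
lift_definition scaleC_poly_mapping :: "complex \<Rightarrow> ('a \<Rightarrow>\<^sub>0 'b) \<Rightarrow> ('a \<Rightarrow>\<^sub>0 'b)"
  is "\<lambda>c f x. c *\<^sub>C f x"
  by (rule finite_subset) auto
instance
  by standard (transfer, auto simp: fun_eq_iff algebra_simps)+
end

(* 'a \<times> 'b \<Rightarrow>\<^sub>0 complex is the free vector space on 'a \<times> 'b, with basis vectors single (a, b) 1. *)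
definition tensor_relations :: "('a::complex_vector \<times> 'b::complex_vector \<Rightarrow>\<^sub>0 complex) set"
  where "tensor_relations = complex_vector.span
    ({Poly_Mapping.single (a + a', b) 1 - Poly_Mapping.single (a, b) 1 - Poly_Mapping.single (a', b) 1
        | a a' b. True} \<union>
     {Poly_Mapping.single (a, b + b') 1 - Poly_Mapping.single (a, b) 1 - Poly_Mapping.single (a, b') 1
        | a b b'. True} \<union>
     {Poly_Mapping.single (c *\<^sub>C a, b) 1 - c *\<^sub>C Poly_Mapping.single (a, b) 1 | c a b. True} \<union>
     {Poly_Mapping.single (a, c *\<^sub>C b) 1 - c *\<^sub>C Poly_Mapping.single (a, b) 1 | c a b. True})"

lemma subspace_tensor_relations: "complex_vector.subspace tensor_relations"
  unfolding tensor_relations_def by (rule complex_vector.subspace_span)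

lemma equivp_tensor_relations:
  "equivp (\<lambda>f g :: 'a::complex_vector \<times> 'b::complex_vector \<Rightarrow>\<^sub>0 complex. f - g \<in> tensor_relations)"
proof (rule equivpI)
  let ?R = "\<lambda>f g :: 'a \<times> 'b \<Rightarrow>\<^sub>0 complex. f - g \<in> tensor_relations"
  note S = subspace_tensor_relations
  show "reflp ?R"
    by (auto intro!: reflpI complex_vector.subspace_0[OF S])
  show "symp ?R"
    by (rule sympI) (metis complex_vector.subspace_neg[OF S] minus_diff_eq)
  show "transp ?R"
  proof (rule transpI)
    fix x y z :: "'a \<times> 'b \<Rightarrow>\<^sub>0 complex"
    assume "x - y \<in> tensor_relations" "y - z \<in> tensor_relations"
    from complex_vector.subspace_add[OF S this] show "x - z \<in> tensor_relations" by simp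
  qed
qed

quotient_type (overloaded) ('a, 'b) tensor =
    "'a::complex_vector \<times> 'b::complex_vector \<Rightarrow>\<^sub>0 complex" /
    "\<lambda>f g. f - g \<in> tensor_relations"
  morphisms rep_tensor abs_tensor
  by (rule equivp_tensor_relations)

instantiation tensor :: (complex_vector, complex_vector) complex_vector
begin
lift_definition zero_tensor :: "('a, 'b) tensor" is 0 .
lift_definition plus_tensor :: "('a, 'b) tensor \<Rightarrow> ('a, 'b) tensor \<Rightarrow> ('a, 'b) tensor" is "(+)"
  by (drule (1) complex_vector.subspace_add[OF subspace_tensor_relations]) (simp add: algebra_simps)
lift_definition minus_tensor :: "('a, 'b) tensor \<Rightarrow> ('a, 'b) tensor \<Rightarrow> ('a, 'b) tensor" is "(-)"
  by (drule (1) complex_vector.subspace_diff[OF subspace_tensor_relations]) (simp add: algebra_simps)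
lift_definition uminus_tensor :: "('a, 'b) tensor \<Rightarrow> ('a, 'b) tensor" is uminus
  by (drule complex_vector.subspace_neg[OF subspace_tensor_relations]) (simp add: algebra_simps)
lift_definition scaleC_tensor :: "complex \<Rightarrow> ('a, 'b) tensor \<Rightarrow> ('a, 'b) tensor" is scaleC
  by (drule complex_vector.subspace_scale[OF subspace_tensor_relations])
    (simp add: complex_vector.scale_right_diff_distrib)
instance
proof
  fix a b c :: "('a, 'b) tensor" and s t :: complex
  note 0 = complex_vector.subspace_0[OF subspace_tensor_relations]
  show "a + b + c = a + (b + c)" by transfer (simp add: 0 add.assoc)
  show "a + b = b + a" by transfer (simp add: 0)
  show "0 + a = a" by transfer (simp add: 0)
  show "- a + a = 0" by transfer (simp add: 0)
  show "a - b = a + - b" by transfer (simp add: 0)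
  show "s *\<^sub>C (a + b) = s *\<^sub>C a + s *\<^sub>C b" by transfer (simp add: 0 scaleC_add_right)
  show "(s + t) *\<^sub>C a = s *\<^sub>C a + t *\<^sub>C a" by transfer (simp add: 0 scaleC_add_left)
  show "s *\<^sub>C t *\<^sub>C a = (s * t) *\<^sub>C a" by transfer (simp add: 0)
  show "1 *\<^sub>C a = a" by transfer (simp add: 0)
qed
end

lift_definition pure_tensor :: "'a::complex_vector \<Rightarrow> 'b::complex_vector \<Rightarrow> ('a, 'b) tensor"
    (infixr \<open>\<otimes>\<close> 70)
  is "\<lambda>a b. Poly_Mapping.single (a, b) 1" .

definition free_lift :: "('a \<Rightarrow> 'b \<Rightarrow> 'c) \<Rightarrow> ('a \<times> 'b \<Rightarrow>\<^sub>0 complex) \<Rightarrow> 'c::complex_vector"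
  where "free_lift f p = (\<Sum>x \<in> Poly_Mapping.keys p. Poly_Mapping.lookup p x *\<^sub>C f (fst x) (snd x))"

(* For bilinear f this is the unique linear map with a \<otimes> b \<mapsto> f a b: see tensor_lift_pure,
   clinear_tensor_lift and tensor_ext below. *)
definition tensor_lift ::
    "('a::complex_vector \<Rightarrow> 'b::complex_vector \<Rightarrow> 'c::complex_vector) \<Rightarrow> ('a, 'b) tensor \<Rightarrow> 'c"
  where "tensor_lift f t = free_lift f (rep_tensor t)"

lemma free_lift_superset:
  assumes "finite A" "Poly_Mapping.keys p \<subseteq> A"
  shows "free_lift f p = (\<Sum>x \<in> A. Poly_Mapping.lookup p x *\<^sub>C f (fst x) (snd x))"
  unfolding free_lift_def
  by (rule sum.mono_neutral_left) (use assms in \<open>auto simp: in_keys_iff\<close>)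

lemma clinear_free_lift: "clinear (free_lift f)"
proof (rule clinearI)
  fix p q :: "'a \<times> 'b \<Rightarrow>\<^sub>0 complex" and c :: complex
  let ?A = "Poly_Mapping.keys p \<union> Poly_Mapping.keys q"
  have "Poly_Mapping.keys (p + q) \<subseteq> ?A"
    by (rule Poly_Mapping.keys_add)
  then show "free_lift f (p + q) = free_lift f p + free_lift f q"
    by (simp add: free_lift_superset[where A = ?A] lookup_add scaleC_add_left sum.distrib)
  have "Poly_Mapping.keys (c *\<^sub>C p) \<subseteq> Poly_Mapping.keys p"
    by (auto simp: in_keys_iff scaleC_poly_mapping.rep_eq)
  then show "free_lift f (c *\<^sub>C p) = c *\<^sub>C free_lift f p"
    by (simp add: free_lift_superset[where A = "Poly_Mapping.keys p"] scaleC_poly_mapping.rep_eq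
        complex_vector.scale_sum_right scaleC_complex_def)
qed

lemma free_lift_single: "free_lift f (Poly_Mapping.single (a, b) 1) = f a b"
  by (simp add: free_lift_def)

lemma free_lift_relations:
  assumes "cbilinear f" "p \<in> tensor_relations"
  shows "free_lift f p = 0"
  using assms(2) unfolding tensor_relations_def
proof (induction rule: complex_vector.span_induct)
  case base
  have "free_lift f 0 = 0" by (rule clinear_0[OF clinear_free_lift])
  then show ?case
    by (auto simp: complex_vector.subspace_def clinear_add[OF clinear_free_lift]
        clinear_scale[OF clinear_free_lift])
next
  case (step p)
  then show ?case
    by (auto simp: clinear_diff[OF clinear_free_lift] clinear_scale[OF clinear_free_lift]
        free_lift_single cbilinearD[OF assms(1)])
qed

lemma tensor_lift_abs:
  assumes "cbilinear f"
  shows "tensor_lift f (abs_tensor p) = free_lift f p"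
proof -
  have "rep_tensor (abs_tensor p) - p \<in> tensor_relations"
    by (simp only: tensor.abs_eq_iff[symmetric] Quotient_abs_rep[OF Quotient_tensor])
  from free_lift_relations[OF assms this] show ?thesis
    by (simp add: tensor_lift_def clinear_diff[OF clinear_free_lift])
qed

lemma tensor_lift_pure [simp]: "cbilinear f \<Longrightarrow> tensor_lift f (a \<otimes> b) = f a b"
  by (simp add: pure_tensor.abs_eq tensor_lift_abs free_lift_single)

lemma clinear_tensor_lift:
  assumes "cbilinear f"
  shows "clinear (tensor_lift f)"
proof (rule clinearI)
  fix s t :: "('a, 'b) tensor" and c :: complex
  obtain p q where s: "s = abs_tensor p" and t: "t = abs_tensor q"
    using Quotient_abs_rep[OF Quotient_tensor] by metis
  show "tensor_lift f (s + t) = tensor_lift f s + tensor_lift f t"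
    by (simp add: s t plus_tensor.abs_eq tensor_lift_abs[OF assms] clinear_add[OF clinear_free_lift])
  show "tensor_lift f (c *\<^sub>C s) = c *\<^sub>C tensor_lift f s"
    by (simp add: s scaleC_tensor.abs_eq tensor_lift_abs[OF assms]
        clinear_scale[OF clinear_free_lift])
qed

lemma pure_tensor_bilinear:
  "(a + a') \<otimes> b = a \<otimes> b + a' \<otimes> b" "a \<otimes> (b + b') = a \<otimes> b + a \<otimes> b'"
  "(c *\<^sub>C a) \<otimes> b = c *\<^sub>C (a \<otimes> b)" "a \<otimes> (c *\<^sub>C b) = c *\<^sub>C (a \<otimes> b)"
proof -
  show "(a + a') \<otimes> b = a \<otimes> b + a' \<otimes> b"
    by transfer (unfold tensor_relations_def diff_diff_eq[symmetric],
        rule complex_vector.span_base, rule UnI1, rule UnI1, rule UnI1, blast)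
  show "a \<otimes> (b + b') = a \<otimes> b + a \<otimes> b'"
    by transfer (unfold tensor_relations_def diff_diff_eq[symmetric],
        rule complex_vector.span_base, rule UnI1, rule UnI1, rule UnI2, blast)
  show "(c *\<^sub>C a) \<otimes> b = c *\<^sub>C (a \<otimes> b)"
    by transfer (unfold tensor_relations_def,
        rule complex_vector.span_base, rule UnI1, rule UnI2, blast)
  show "a \<otimes> (c *\<^sub>C b) = c *\<^sub>C (a \<otimes> b)"
    by transfer (unfold tensor_relations_def,
        rule complex_vector.span_base, rule UnI2, blast)
qed

lemma cbilinear_pure_tensor: "cbilinear pure_tensor"
  by (rule cbilinearI) (simp_all add: pure_tensor_bilinear)

lemma tensor_induct [case_names pure scale add]:
  assumes "\<And>a b. P (a \<otimes> b)" "\<And>c t. P t \<Longrightarrow> P (c *\<^sub>C t)" "\<And>s t. P s \<Longrightarrow> P t \<Longrightarrow> P (s + t)"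
  shows "P t"
proof -
  have zero: "P 0" using assms(2)[OF assms(1), of 0] by simp
  have "P (abs_tensor p)" for p
  proof (induction p rule: update_induct)
    case const
    then show ?case using zero by (simp add: zero_tensor.abs_eq)
  next
    case (update f x c)
    have "Poly_Mapping.update x c f = f + c *\<^sub>C Poly_Mapping.single (fst x, snd x) 1"
      using update.hyps(1)
      by (intro poly_mapping_eqI)
        (auto simp: lookup_update lookup_add scaleC_poly_mapping.rep_eq scaleC_complex_def
          lookup_single when_def in_keys_iff)
    then show ?case
      using assms(3)[OF update.IH assms(2)[OF assms(1)[of "fst x" "snd x"], of c]]
      by (simp add: scaleC_tensor.abs_eq pure_tensor.abs_eq plus_tensor.abs_eq)
  qed
  then have "P (abs_tensor (rep_tensor t))" .
  then show ?thesis by (simp only: Quotient_abs_rep[OF Quotient_tensor])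
qed

lemma tensor_ext:
  assumes "clinear f" "clinear g" "\<And>a b. f (a \<otimes> b) = g (a \<otimes> b)"
  shows "f t = g t"
  by (induction t rule: tensor_induct) (simp_all add: assms clinear_add clinear_scale)

lemma tensor_lift_add: "tensor_lift (\<lambda>a b. f a b + g a b) t = tensor_lift f t + tensor_lift g t"
  by (simp add: tensor_lift_def free_lift_def scaleC_add_right sum.distrib)

lemma tensor_lift_scale: "tensor_lift (\<lambda>a b. c *\<^sub>C f a b) t = c *\<^sub>C tensor_lift f t"
  by (simp add: tensor_lift_def free_lift_def complex_vector.scale_sum_right mult.commute)


section \<open>Operations on tensor products\<close>

definition tensor_flip :: "('a::complex_vector, 'b::complex_vector) tensor \<Rightarrow> ('b, 'a) tensor"
  where "tensor_flip = tensor_lift (\<lambda>a b. b \<otimes> a)"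

definition tensor_map ::
    "('a \<Rightarrow> 'c) \<Rightarrow> ('b \<Rightarrow> 'd) \<Rightarrow> ('a::complex_vector, 'b::complex_vector) tensor
      \<Rightarrow> ('c::complex_vector, 'd::complex_vector) tensor"
  where "tensor_map f g = tensor_lift (\<lambda>a b. f a \<otimes> g b)"

definition tensor_assoc ::
    "(('a::complex_vector, 'b::complex_vector) tensor, 'c::complex_vector) tensor
      \<Rightarrow> ('a, ('b, 'c) tensor) tensor"
  where "tensor_assoc = tensor_lift (\<lambda>t c. tensor_lift (\<lambda>a b. a \<otimes> (b \<otimes> c)) t)"

instantiation tensor :: (complex_algebra_1, complex_algebra_1) complex_algebra_1
begin

definition one_tensor :: "('a, 'b) tensor"
  where "one_tensor = 1 \<otimes> 1"

definition times_tensor :: "('a, 'b) tensor \<Rightarrow> ('a, 'b) tensor \<Rightarrow> ('a, 'b) tensor"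
  where "times_tensor s t = tensor_lift (\<lambda>a b. tensor_lift (\<lambda>c d. (a * c) \<otimes> (b * d)) t) s"

lemma cbilinear_times_inner:
  "cbilinear (\<lambda>c d. ((a::'a) * c) \<otimes> ((b::'b) * d))"
  by (rule cbilinearI) (simp_all add: distrib_left mult_scaleC_right pure_tensor_bilinear)

lemma cbilinear_times_outer:
  "cbilinear (\<lambda>(a::'a) (b::'b). tensor_lift (\<lambda>c d. (a * c) \<otimes> (b * d)) t)"
  by (rule cbilinearI)
    (simp_all add: distrib_right mult_scaleC_left pure_tensor_bilinear tensor_lift_add tensor_lift_scale)

lemma tensor_times_pure: "((a::'a) \<otimes> (b::'b)) * (c \<otimes> d) = (a * c) \<otimes> (b * d)"
  unfolding times_tensor_def
  by (subst tensor_lift_pure[OF cbilinear_times_outer]) (rule tensor_lift_pure[OF cbilinear_times_inner])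

lemma cbilinear_times_tensor: "cbilinear ((*) :: ('a, 'b) tensor \<Rightarrow> _)"
  unfolding times_tensor_def
  by (rule cbilinearI)
    (simp_all add: clinear_add[OF clinear_tensor_lift] clinear_scale[OF clinear_tensor_lift]
      cbilinear_times_inner cbilinear_times_outer tensor_lift_add tensor_lift_scale)

instance
proof
  fix x y z :: "('a, 'b) tensor" and c :: complex
  note b = cbilinearD[OF cbilinear_times_tensor]
  show "(x + y) * z = x * z + y * z" "x * (y + z) = x * y + x * z"
    "(c *\<^sub>C x) * y = c *\<^sub>C (x * y)" "x * (c *\<^sub>C y) = c *\<^sub>C (x * y)"
    by (simp_all only: b)
  show "1 * x = x"
    by (induction x rule: tensor_induct) (simp_all add: one_tensor_def tensor_times_pure b)
  show "x * 1 = x"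
    by (induction x rule: tensor_induct) (simp_all add: one_tensor_def tensor_times_pure b)
  show "x * y * z = x * (y * z)"
  proof (induction x rule: tensor_induct)
    case (pure a1 a2)
    show ?case
    proof (induction y rule: tensor_induct)
      case (pure b1 b2)
      show ?case
        by (induction z rule: tensor_induct) (simp_all only: tensor_times_pure b mult.assoc)
    qed (simp_all only: b)
  qed (simp_all only: b)
qed

end

lemma tensor_flip_pure [simp]: "tensor_flip (a \<otimes> b) = b \<otimes> a"
  unfolding tensor_flip_def
  by (rule tensor_lift_pure) (rule cbilinearI, simp_all add: pure_tensor_bilinear)

lemma cbilinear_tensor_map:
  "clinear f \<Longrightarrow> clinear g \<Longrightarrow> cbilinear (\<lambda>a b. f a \<otimes> g b)"
  by (rule cbilinearI) (simp_all add: pure_tensor_bilinear clinear_add clinear_scale)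

lemma tensor_map_pure:
  "clinear f \<Longrightarrow> clinear g \<Longrightarrow> tensor_map f g (a \<otimes> b) = f a \<otimes> g b"
  unfolding tensor_map_def by (rule tensor_lift_pure) (rule cbilinear_tensor_map)

lemma tensor_assoc_pure [simp]: "tensor_assoc ((a \<otimes> b) \<otimes> c) = a \<otimes> (b \<otimes> c)"
proof -
  have inner: "cbilinear (\<lambda>a b. a \<otimes> (b \<otimes> c))" for c :: 'c
    by (rule cbilinearI) (simp_all add: pure_tensor_bilinear)
  have "cbilinear (\<lambda>t c. tensor_lift (\<lambda>(a::'a) (b::'b). a \<otimes> (b \<otimes> (c::'c))) t)"
    by (rule cbilinearI)
      (simp_all add: pure_tensor_bilinear tensor_lift_add tensor_lift_scale
        clinear_add[OF clinear_tensor_lift[OF inner]] clinear_scale[OF clinear_tensor_lift[OF inner]])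
  then show ?thesis by (simp add: tensor_assoc_def inner)
qed


section \<open>Complex conjugate vector spaces\<close>

(* map_conjugate T is the conjugate of a linear map T: it sends Bar v to Bar (T v). *)
datatype 'a conjugate = Bar (unbar: 'a)

instantiation conjugate :: (complex_vector) complex_vector
begin
definition zero_conjugate :: "'a conjugate" where "0 = Bar 0"
definition plus_conjugate :: "'a conjugate \<Rightarrow> 'a conjugate \<Rightarrow> 'a conjugate"
  where "x + y = Bar (unbar x + unbar y)"
definition minus_conjugate :: "'a conjugate \<Rightarrow> 'a conjugate \<Rightarrow> 'a conjugate"
  where "x - y = Bar (unbar x - unbar y)"
definition uminus_conjugate :: "'a conjugate \<Rightarrow> 'a conjugate"
  where "- x = Bar (- unbar x)"
definition scaleC_conjugate :: "complex \<Rightarrow> 'a conjugate \<Rightarrow> 'a conjugate"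
  where "c *\<^sub>C x = Bar (cnj c *\<^sub>C unbar x)"
instance
  by standard (simp_all add: zero_conjugate_def plus_conjugate_def minus_conjugate_def
      uminus_conjugate_def scaleC_conjugate_def add.assoc add.commute scaleC_add_left scaleC_add_right)
end

lemma Bar_add: "Bar (v + w) = Bar v + Bar w"
  by (simp add: plus_conjugate_def)

lemma Bar_scaleC: "Bar (c *\<^sub>C v) = cnj c *\<^sub>C Bar v"
  by (simp add: scaleC_conjugate_def)

lemma unbar_add: "unbar (x + y) = unbar x + unbar y"
  by (simp add: plus_conjugate_def)

lemma unbar_scaleC: "unbar (c *\<^sub>C x) = cnj c *\<^sub>C unbar x"
  by (simp add: scaleC_conjugate_def)

definition double_conj :: "'v conjugate conjugate \<Rightarrow> 'v"
  where "double_conj x = unbar (unbar x)"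

(* The antilinear extension of v \<otimes> w \<mapsto> f v w, for f antilinear in each argument.
   Composition with Bar turns it into a linear extension problem. *)
definition antilinear_lift ::
    "('a::complex_vector \<Rightarrow> 'b::complex_vector \<Rightarrow> 'c::complex_vector) \<Rightarrow> ('a, 'b) tensor \<Rightarrow> 'c"
  where "antilinear_lift f t = unbar (tensor_lift (\<lambda>a b. Bar (f a b)) t)"

definition conj_flip ::
    "('v::complex_vector, 'w::complex_vector) tensor conjugate \<Rightarrow> ('w conjugate, 'v conjugate) tensor"
  where "conj_flip x = antilinear_lift (\<lambda>v w. Bar w \<otimes> Bar v) (unbar x)"

lemma cbilinear_Bar:
  assumes "\<And>a. antilinear (f a)" "\<And>b. antilinear (\<lambda>a. f a b)"
  shows "cbilinear (\<lambda>a b. Bar (f a b))"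
  by (rule cbilinearI) (use assms in \<open>simp_all add: antilinear_def Bar_add Bar_scaleC\<close>)

lemma antilinear_lift_pure:
  assumes "\<And>a. antilinear (f a)" "\<And>b. antilinear (\<lambda>a. f a b)"
  shows "antilinear_lift f (a \<otimes> b) = f a b"
  by (simp add: antilinear_lift_def cbilinear_Bar[OF assms])

lemma antilinear_antilinear_lift:
  assumes "\<And>a. antilinear (f a)" "\<And>b. antilinear (\<lambda>a. f a b)"
  shows "antilinear (antilinear_lift f)"
  unfolding antilinear_def antilinear_lift_def
  using clinear_tensor_lift[OF cbilinear_Bar[OF assms]]
  by (simp add: clinear_add clinear_scale unbar_add unbar_scaleC)

lemma antilinear_conj_flip:
  "antilinear (\<lambda>w. Bar w \<otimes> Bar v)" "antilinear (\<lambda>v. Bar w \<otimes> Bar v)"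
  by (simp_all add: antilinear_def Bar_add Bar_scaleC pure_tensor_bilinear)

lemma conj_flip_pure [simp]: "conj_flip (Bar (v \<otimes> w)) = Bar w \<otimes> Bar v"
  by (simp add: conj_flip_def antilinear_lift_pure antilinear_conj_flip)

lemma clinear_conj_flip:
  "clinear (conj_flip :: ('v::complex_vector, 'w::complex_vector) tensor conjugate \<Rightarrow> _)"
proof -
  have "antilinear (antilinear_lift (\<lambda>(v::'v) (w::'w). Bar w \<otimes> Bar v))"
    by (intro antilinear_antilinear_lift antilinear_conj_flip)
  then show ?thesis
    by (intro clinearI) (simp_all add: conj_flip_def antilinear_def unbar_add unbar_scaleC)
qed

lemma bij_conj_flip:
  "bij (conj_flip :: ('v::complex_vector, 'w::complex_vector) tensor conjugate \<Rightarrow> _)"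
proof -
  define g :: "('w conjugate, 'v conjugate) tensor \<Rightarrow> ('v, 'w) tensor conjugate"
    where "g = tensor_lift (\<lambda>x y. Bar (unbar y \<otimes> unbar x))"
  have bil: "cbilinear (\<lambda>(x :: 'w conjugate) (y :: 'v conjugate). Bar (unbar y \<otimes> unbar x))"
    by (rule cbilinearI)
      (simp_all add: unbar_add unbar_scaleC pure_tensor_bilinear Bar_add Bar_scaleC)
  have g: "g (x \<otimes> y) = Bar (unbar y \<otimes> unbar x)" for x y
    by (simp add: g_def bil)
  have g_lin: "clinear g"
    unfolding g_def by (rule clinear_tensor_lift[OF bil])
  have gf: "g (conj_flip (Bar t)) = Bar t" for t
    by (induction t rule: tensor_induct)
      (simp_all add: g Bar_add Bar_scaleC clinear_add[OF g_lin] clinear_scale[OF g_lin]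
        clinear_add[OF clinear_conj_flip] clinear_scale[OF clinear_conj_flip])
  have fg: "conj_flip (g t) = t" for t
    by (induction t rule: tensor_induct)
      (simp_all add: g clinear_add[OF g_lin] clinear_scale[OF g_lin]
        clinear_add[OF clinear_conj_flip] clinear_scale[OF clinear_conj_flip])
  show ?thesis
    by (rule o_bij[of g]) (simp_all add: fun_eq_iff fg, metis gf conjugate.collapse)
qed

lemma bij_double_conj: "bij double_conj"
  by (rule o_bij[of "\<lambda>v. Bar (Bar v)"]) (auto simp: double_conj_def)


section \<open>Hopf *-algebras and universal R-matrices\<close>

(* The multiplicative inverse, meaningful only for two-sided invertible elements. *)
definition alg_inv :: "'a::monoid_mult \<Rightarrow> 'a"
  where "alg_inv x = (THE y. x * y = 1 \<and> y * x = 1)"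

definition alg_invertible :: "'a::monoid_mult \<Rightarrow> bool"
  where "alg_invertible x \<longleftrightarrow> (\<exists>y. x * y = 1 \<and> y * x = 1)"

lemma alg_inv:
  assumes "alg_invertible x"
  shows "x * alg_inv x = 1" "alg_inv x * x = 1"
proof -
  obtain y where y: "x * y = 1" "y * x = 1" using assms by (auto simp: alg_invertible_def)
  have "alg_inv x = y"
    unfolding alg_inv_def
    by (rule the_equality) (use y in \<open>auto, metis mult.assoc mult_1_left mult_1_right\<close>)
  then show "x * alg_inv x = 1" "alg_inv x * x = 1" using y by simp_all
qed

locale hopf_algebra =
  fixes \<Delta> :: "'h::complex_algebra_1 \<Rightarrow> ('h, 'h) tensor"
    and \<epsilon> :: "'h \<Rightarrow> complex"
    and S :: "'h \<Rightarrow> 'h"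
  assumes linear_comult: "clinear \<Delta>"
    and linear_counit: "clinear \<epsilon>"
    and linear_antipode: "clinear S"
    and coassoc: "tensor_assoc (tensor_map \<Delta> id (\<Delta> a)) = tensor_map id \<Delta> (\<Delta> a)"
    and counit_left: "tensor_lift (\<lambda>x y. \<epsilon> x *\<^sub>C y) (\<Delta> a) = a"
    and counit_right: "tensor_lift (\<lambda>x y. \<epsilon> y *\<^sub>C x) (\<Delta> a) = a"
    and comult_mult: "\<Delta> (a * b) = \<Delta> a * \<Delta> b"
    and comult_one: "\<Delta> 1 = 1"
    and counit_mult: "\<epsilon> (a * b) = \<epsilon> a * \<epsilon> b"
    and counit_one: "\<epsilon> 1 = 1"
    and antipode_left: "tensor_lift (\<lambda>x y. S x * y) (\<Delta> a) = \<epsilon> a *\<^sub>C 1"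
    and antipode_right: "tensor_lift (\<lambda>x y. x * S y) (\<Delta> a) = \<epsilon> a *\<^sub>C 1"

definition tensor_star ::
    "('h \<Rightarrow> 'h) \<Rightarrow> ('h::complex_algebra_1, 'h) tensor \<Rightarrow> ('h, 'h) tensor"
  where "tensor_star star = antilinear_lift (\<lambda>a b. star a \<otimes> star b)"

lemma tensor_star_pure:
  "antilinear star \<Longrightarrow> tensor_star star (a \<otimes> b) = star a \<otimes> star b"
  unfolding tensor_star_def
  by (rule antilinear_lift_pure) (simp_all add: antilinear_def pure_tensor_bilinear)

locale hopf_star_algebra = hopf_algebra \<Delta> \<epsilon> S
  for \<Delta> :: "'h::complex_algebra_1 \<Rightarrow> ('h, 'h) tensor"
    and \<epsilon> :: "'h \<Rightarrow> complex"
    and S :: "'h \<Rightarrow> 'h" +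
  fixes star :: "'h \<Rightarrow> 'h"
  assumes antilinear_star: "antilinear star"
    and star_star: "star (star a) = a"
    and star_mult: "star (a * b) = star b * star a"
    and comult_star: "\<Delta> (star a) = tensor_star star (\<Delta> a)"

definition leg12 :: "('h::complex_algebra_1, 'h) tensor \<Rightarrow> ('h, ('h, 'h) tensor) tensor"
  where "leg12 = tensor_lift (\<lambda>a b. a \<otimes> (b \<otimes> 1))"

definition leg13 :: "('h::complex_algebra_1, 'h) tensor \<Rightarrow> ('h, ('h, 'h) tensor) tensor"
  where "leg13 = tensor_lift (\<lambda>a b. a \<otimes> (1 \<otimes> b))"

definition leg23 :: "('h::complex_algebra_1, 'h) tensor \<Rightarrow> ('h, ('h, 'h) tensor) tensor"
  where "leg23 = tensor_lift (\<lambda>a b. 1 \<otimes> (a \<otimes> b))"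

lemma leg_pure [simp]:
  "leg12 (a \<otimes> b) = a \<otimes> (b \<otimes> 1)" "leg13 (a \<otimes> b) = a \<otimes> (1 \<otimes> b)" "leg23 (a \<otimes> b) = 1 \<otimes> (a \<otimes> b)"
  unfolding leg12_def leg13_def leg23_def
  by (rule tensor_lift_pure, rule cbilinearI, simp_all add: pure_tensor_bilinear)+

locale quasitriangular_hopf_algebra = hopf_algebra \<Delta> \<epsilon> S
  for \<Delta> :: "'h::complex_algebra_1 \<Rightarrow> ('h, 'h) tensor"
    and \<epsilon> :: "'h \<Rightarrow> complex"
    and S :: "'h \<Rightarrow> 'h" +
  fixes R :: "('h, 'h) tensor"
  assumes R_invertible: "alg_invertible R"
    and R_comult: "R * \<Delta> a * alg_inv R = tensor_flip (\<Delta> a)"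
    and comult_id_R: "tensor_assoc (tensor_map \<Delta> id R) = leg13 R * leg23 R"
    and id_comult_R: "tensor_map id \<Delta> R = leg13 R * leg12 R"

locale quasitriangular_hopf_star_algebra =
  hopf_star_algebra \<Delta> \<epsilon> S star + quasitriangular_hopf_algebra \<Delta> \<epsilon> S R
  for \<Delta> \<epsilon> S star R

definition real_R_matrix :: "('h \<Rightarrow> 'h) \<Rightarrow> ('h::complex_algebra_1, 'h) tensor \<Rightarrow> bool"
  where "real_R_matrix star R \<longleftrightarrow> tensor_star star R = tensor_flip R"

definition inverse_real_R_matrix :: "('h \<Rightarrow> 'h) \<Rightarrow> ('h::complex_algebra_1, 'h) tensor \<Rightarrow> bool"
  where "inverse_real_R_matrix star R \<longleftrightarrow> tensor_star star R = alg_inv R"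


section \<open>Modules, braiding and conjugate braiding\<close>

locale left_module =
  fixes act :: "'h::complex_algebra_1 \<Rightarrow> 'v::complex_vector \<Rightarrow> 'v"
  assumes bilinear_act: "cbilinear act"
    and act_one: "act 1 v = v"
    and act_mult: "act (a * b) v = act a (act b v)"

(* The coordinate-wise action of H \<otimes> H on U \<otimes> V. *)
definition tensor_act ::
    "('h \<Rightarrow> 'u \<Rightarrow> 'u) \<Rightarrow> ('h \<Rightarrow> 'v \<Rightarrow> 'v) \<Rightarrow> ('h::complex_algebra_1, 'h) tensor
      \<Rightarrow> ('u::complex_vector, 'v::complex_vector) tensor \<Rightarrow> ('u, 'v) tensor"
  where "tensor_act actU actV r x = tensor_lift (\<lambda>a b. tensor_map (actU a) (actV b) x) r"

lemma tensor_act_pure: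
  assumes "left_module actU" "left_module actV"
  shows "tensor_act actU actV (a \<otimes> b) (u \<otimes> v) = actU a u \<otimes> actV b v"
proof -
  note U = left_module.bilinear_act[OF assms(1)] and V = left_module.bilinear_act[OF assms(2)]
  have bil: "cbilinear (\<lambda>a b. tensor_map (actU a) (actV b) x)" for x
    unfolding tensor_map_def
    by (rule cbilinearI)
      (simp_all add: cbilinearD[OF U] cbilinearD[OF V] pure_tensor_bilinear
        tensor_lift_add tensor_lift_scale)
  have "tensor_act actU actV (a \<otimes> b) x = tensor_map (actU a) (actV b) x" for x
    unfolding tensor_act_def by (rule tensor_lift_pure[OF bil])
  then show ?thesis
    using U V by (simp add: tensor_map_pure cbilinear_def)
qed

definition braiding ::
    "('h, 'h) tensor \<Rightarrow> ('h \<Rightarrow> 'u \<Rightarrow> 'u) \<Rightarrow> ('h::complex_algebra_1 \<Rightarrow> 'v \<Rightarrow> 'v)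
      \<Rightarrow> ('u::complex_vector, 'v::complex_vector) tensor \<Rightarrow> ('v, 'u) tensor"
  where "braiding R actU actV = tensor_flip \<circ> tensor_act actU actV R"

definition conj_act ::
    "('h \<Rightarrow> 'h) \<Rightarrow> ('h \<Rightarrow> 'h) \<Rightarrow> ('h \<Rightarrow> 'v \<Rightarrow> 'v) \<Rightarrow> 'h \<Rightarrow> 'v conjugate \<Rightarrow> 'v conjugate"
  where "conj_act S star act a x = Bar (act (star (S a)) (unbar x))"

(* A braiding is a family of maps indexed by pairs of modules. The maps xi_XY and conj-psi_XY
   each involve a single component of it, which is the argument \<psi> below:
   psi_YX for xi_XY, and psi_YX at the modules conj-Y, conj-X for conj-psi_XY. *)
definition xi ::
    "(('y::complex_vector, 'x::complex_vector) tensor \<Rightarrow> ('x, 'y) tensor)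
      \<Rightarrow> ('x conjugate, 'y conjugate) tensor \<Rightarrow> ('y conjugate, 'x conjugate) tensor"
  where "xi \<psi> = conj_flip \<circ> map_conjugate \<psi> \<circ> inv conj_flip"

definition conj_braiding ::
    "(('y::complex_vector conjugate, 'x::complex_vector conjugate) tensor
        \<Rightarrow> ('x conjugate, 'y conjugate) tensor)
      \<Rightarrow> ('x, 'y) tensor \<Rightarrow> ('y, 'x) tensor"
  where "conj_braiding \<psi> =
    tensor_map double_conj double_conj \<circ> xi \<psi> \<circ> tensor_map (inv double_conj) (inv double_conj)"

end

theory Submission
  imports Defs
begin

text \<open>
  Write \<open>R = \<Sum> a \<otimes> b\<close>. Unwinding the two conjugations shows that the conjugate braiding sends
  \<open>x \<otimes> y\<close> to the flip of \<open>\<Sum> (S b)\<^sup>* x \<otimes> (S a)\<^sup>* y\<close>; that is, it is the braiding built in the same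
  way from the element \<open>((S \<otimes> S) R)\<^sup>*\<close> with its two legs exchanged
  (\<open>conj_braiding_of_braiding\<close>).

  The algebraic input is the identity \<open>(S \<otimes> S) R = R\<close> (\<open>antipode_antipode_R\<close>). It comes from
  \<open>(S \<otimes> id) R = R\<^sup>-\<^sup>1\<close> and \<open>(id \<otimes> S) R\<^sup>-\<^sup>1 = R\<close>, each obtained by multiplying together, after
  applying the antipode to one of them, the two legs of the coproduct in a hexagon identity. So the
  conjugate braiding is given by \<open>(R\<^sup>*)\<^sub>2\<^sub>1\<close>. If \<open>R\<^sup>* = R\<^sub>2\<^sub>1\<close> this element is \<open>R\<close>. If
  \<open>R\<^sup>* = R\<^sup>-\<^sup>1\<close>, moving the flip past the action turns the conjugate braiding into \<open>R\<^sup>-\<^sup>1\<close> acting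
  after the flip, which is the inverse of \<open>\<psi>\<close> in the opposite order.
\<close>

section \<open>Linear maps on tensor products\<close>

lemma clinear_id: "clinear id" "clinear (\<lambda>x. x)"
  by (rule clinearI, simp_all)+

lemma clinear_inv:
  assumes "clinear f" "bij f"
  shows "clinear (inv f)"
proof (rule clinearI)
  have f: "f (inv f x) = x" for x
    using assms(2) by (simp add: bij_is_surj surj_f_inv_f)
  have inj: "inj f" using assms(2) by (rule bij_is_inj)
  show "inv f (x + y) = inv f x + inv f y" for x y
    by (rule injD[OF inj]) (simp add: f clinear_add[OF assms(1)])
  show "inv f (c *\<^sub>C x) = c *\<^sub>C inv f x" for c x
    by (rule injD[OF inj]) (simp add: f clinear_scale[OF assms(1)])
qed

lemma clinear_tensor_map: "clinear f \<Longrightarrow> clinear g \<Longrightarrow> clinear (tensor_map f g)"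
  unfolding tensor_map_def by (intro clinear_tensor_lift cbilinear_tensor_map)

lemma tensor_map_id: "tensor_map id id t = t"
  by (induction t rule: tensor_induct)
    (simp_all add: tensor_map_pure clinear_id clinear_add[OF clinear_tensor_map]
      clinear_scale[OF clinear_tensor_map])

lemma clinear_tensor_flip: "clinear tensor_flip"
  unfolding tensor_flip_def
  by (rule clinear_tensor_lift) (rule cbilinearI, simp_all add: pure_tensor_bilinear)

lemma tensor_flip_flip [simp]: "tensor_flip (tensor_flip t) = t"
  by (induction t rule: tensor_induct)
    (simp_all add: clinear_add[OF clinear_tensor_flip] clinear_scale[OF clinear_tensor_flip])

lemma clinear_tensor_assoc: "clinear tensor_assoc"
proof -
  have inner: "cbilinear (\<lambda>a b. a \<otimes> (b \<otimes> c))" for c :: 'c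
    by (rule cbilinearI) (simp_all add: pure_tensor_bilinear)
  show ?thesis
    unfolding tensor_assoc_def
    by (rule clinear_tensor_lift, rule cbilinearI)
      (simp_all add: pure_tensor_bilinear tensor_lift_add tensor_lift_scale
        clinear_add[OF clinear_tensor_lift[OF inner]] clinear_scale[OF clinear_tensor_lift[OF inner]])
qed

text \<open>Multiplicativity of a linear map on a tensor product of algebras can be tested on pure tensors,
  since both sides are bilinear.\<close>

lemma tensor_multiplicativeI:
  fixes f :: "('a::complex_algebra_1, 'b::complex_algebra_1) tensor \<Rightarrow> 'c::complex_algebra_1"
  assumes lin: "clinear f"
    and pure: "\<And>a b c d. f ((a \<otimes> b) * (c \<otimes> d)) = f (a \<otimes> b) * f (c \<otimes> d)"
  shows "f (s * t) = f s * f t"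
proof (induction s rule: tensor_induct)
  case (pure a b)
  show ?case
    by (induction t rule: tensor_induct)
      (simp_all add: assms(2) clinear_add[OF lin] clinear_scale[OF lin] distrib_left
        mult_scaleC_right)
qed (simp_all add: clinear_add[OF lin] clinear_scale[OF lin] distrib_right mult_scaleC_left)

lemma clinear_leg: "clinear leg12" "clinear leg13" "clinear leg23"
  unfolding leg12_def leg13_def leg23_def
  by (rule clinear_tensor_lift, rule cbilinearI, simp_all add: pure_tensor_bilinear)+

lemma leg12_mult: "leg12 (s * t) = leg12 s * leg12 t"
  by (rule tensor_multiplicativeI[OF clinear_leg(1)]) (simp add: tensor_times_pure)

lemma leg13_mult: "leg13 (s * t) = leg13 s * leg13 t"
  by (rule tensor_multiplicativeI[OF clinear_leg(2)]) (simp add: tensor_times_pure)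

lemma leg_one: "leg12 1 = 1" "leg13 1 = 1"
  by (simp_all add: one_tensor_def)


section \<open>Contracting a hexagon identity\<close>

text \<open>Applied to either side of a hexagon identity, these contractions multiply together the two legs
  produced by the coproduct, with \<open>h\<close> acting on one of them. For \<open>h\<close> the antipode or \<open>\<epsilon>(\<cdot>) 1\<close>, the
  resulting expression in \<open>\<Delta> a\<close> is the one in the antipode or the counit axiom.\<close>

definition contract_left ::
    "('h \<Rightarrow> 'h) \<Rightarrow> ('h::complex_algebra_1, ('h, 'h) tensor) tensor \<Rightarrow> ('h, 'h) tensor"
  where "contract_left h = tensor_lift (\<lambda>a t. (h a \<otimes> 1) * t)"

definition contract_right ::
    "('h \<Rightarrow> 'h) \<Rightarrow> ('h::complex_algebra_1, ('h, 'h) tensor) tensor \<Rightarrow> ('h, 'h) tensor"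
  where "contract_right h = tensor_map id (tensor_lift (\<lambda>b c. b * h c))"

lemma cbilinear_mult_left: "clinear h \<Longrightarrow> cbilinear (\<lambda>a b. h a * (b::'h::complex_algebra_1))"
  by (rule cbilinearI)
    (simp_all add: clinear_add clinear_scale distrib_left distrib_right mult_scaleC_left
      mult_scaleC_right)

lemma cbilinear_mult_right: "clinear h \<Longrightarrow> cbilinear (\<lambda>a b. (a::'h::complex_algebra_1) * h b)"
  by (rule cbilinearI)
    (simp_all add: clinear_add clinear_scale distrib_left distrib_right mult_scaleC_left
      mult_scaleC_right)

lemma
  assumes "clinear h"
  shows clinear_contract_left: "clinear (contract_left h)"
    and contract_left_pure: "contract_left h (a \<otimes> t) = (h a \<otimes> 1) * t"
proof -
  have bil: "cbilinear (\<lambda>a t. (h a \<otimes> 1) * (t::('a, 'a) tensor))"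
    by (rule cbilinearI)
      (simp_all add: clinear_add[OF assms] clinear_scale[OF assms] pure_tensor_bilinear
        distrib_left distrib_right mult_scaleC_left mult_scaleC_right)
  show "clinear (contract_left h)"
    unfolding contract_left_def by (rule clinear_tensor_lift[OF bil])
  show "contract_left h (a \<otimes> t) = (h a \<otimes> 1) * t"
    by (simp add: contract_left_def bil)
qed

lemma
  assumes "clinear h"
  shows clinear_contract_right: "clinear (contract_right h)"
    and contract_right_pure: "contract_right h (a \<otimes> t) = a \<otimes> tensor_lift (\<lambda>b c. b * h c) t"
  unfolding contract_right_def
  by (simp_all add: clinear_tensor_map tensor_map_pure clinear_id
      clinear_tensor_lift[OF cbilinear_mult_right[OF assms]])

lemma contract_left_assoc:
  assumes h: "clinear h"
  shows "contract_left h (tensor_assoc (t \<otimes> b)) = tensor_lift (\<lambda>x y. h x * y) t \<otimes> b"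
  by (induction t rule: tensor_induct)
    (simp_all add: contract_left_pure[OF h] tensor_times_pure cbilinear_mult_left[OF h]
      pure_tensor_bilinear
      clinear_add[OF clinear_tensor_assoc] clinear_scale[OF clinear_tensor_assoc]
      clinear_add[OF clinear_contract_left[OF h]] clinear_scale[OF clinear_contract_left[OF h]]
      clinear_add[OF clinear_tensor_lift[OF cbilinear_mult_left[OF h]]]
      clinear_scale[OF clinear_tensor_lift[OF cbilinear_mult_left[OF h]]])

lemma contract_left_legs:
  assumes h: "clinear h"
  shows "contract_left h (leg13 s * leg23 t) = tensor_map h id s * t"
proof (induction s rule: tensor_induct)
  case (pure a b)
  show ?case
    by (induction t rule: tensor_induct)
      (simp_all add: contract_left_pure[OF h] tensor_times_pure tensor_map_pure h clinear_id
        clinear_add[OF clinear_leg(3)] clinear_scale[OF clinear_leg(3)] distrib_left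
        mult_scaleC_right
        clinear_add[OF clinear_contract_left[OF h]] clinear_scale[OF clinear_contract_left[OF h]])
qed (simp_all add: clinear_add[OF clinear_leg(2)] clinear_scale[OF clinear_leg(2)] distrib_right
    mult_scaleC_left h clinear_id
    clinear_add[OF clinear_tensor_map]
    clinear_scale[OF clinear_tensor_map]
    clinear_add[OF clinear_contract_left[OF h]] clinear_scale[OF clinear_contract_left[OF h]])

lemma contract_right_legs:
  assumes h: "clinear h"
  shows "contract_right h (leg12 s * leg13 t) = s * tensor_map id h t"
proof (induction s rule: tensor_induct)
  case (pure a b)
  show ?case
    by (induction t rule: tensor_induct)
      (simp_all add: contract_right_pure[OF h] tensor_times_pure tensor_map_pure h clinear_id
        cbilinear_mult_right[OF h]
        clinear_add[OF clinear_leg(2)] clinear_scale[OF clinear_leg(2)] distrib_left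
        mult_scaleC_right
        clinear_add[OF clinear_tensor_map]
        clinear_scale[OF clinear_tensor_map]
        clinear_add[OF clinear_contract_right[OF h]] clinear_scale[OF clinear_contract_right[OF h]])
qed (simp_all add: clinear_add[OF clinear_leg(1)] clinear_scale[OF clinear_leg(1)] distrib_right
    mult_scaleC_left
    clinear_add[OF clinear_contract_right[OF h]] clinear_scale[OF clinear_contract_right[OF h]])


section \<open>The antipode and the universal R-matrix\<close>

lemma left_inverse_eq_right_inverse:
  assumes "x * y = 1" "y * z = (1::'a::monoid_mult)"
  shows "x = z"
proof -
  have "x = x * (y * z)" by (simp only: assms(2) mult_1_right)
  also have "\<dots> = z" by (simp only: mult.assoc[symmetric] assms(1) mult_1_left)
  finally show ?thesis .
qed

context hopf_algebra
begin

abbreviation unit_counit :: "'h \<Rightarrow> 'h"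
  where "unit_counit a \<equiv> \<epsilon> a *\<^sub>C 1"

lemma clinear_unit_counit: "clinear unit_counit"
  by (rule clinearI)
    (simp_all add: clinear_add[OF linear_counit] clinear_scale[OF linear_counit] scaleC_add_left
      scaleC_complex_def)

text \<open>Contracting the hexagon identity with \<open>h\<close> turns the coproduct into \<open>a \<mapsto> h a\<^sub>1 \<cdot> a\<^sub>2\<close> on one
  side and gives \<open>(h \<otimes> id) T \<cdot> T\<close> on the other. For \<open>h = \<epsilon>(\<cdot>) 1\<close> this reads \<open>T = (h \<otimes> id) T \<cdot> T\<close>, and
  multiplying by \<open>T'\<close> on the right gives \<open>(h \<otimes> id) T = 1\<close>. For \<open>h = S\<close> the antipode axiom identifies
  \<open>(S \<otimes> id) T \<cdot> T\<close> with that same element.\<close>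

lemma antipode_id_left_inverse:
  assumes hex: "tensor_assoc (tensor_map \<Delta> id T) = leg13 T * leg23 T"
    and inv: "T * T' = 1"
  shows "tensor_map S id T * T = 1"
proof -
  have key: "tensor_map h id T * T = tensor_map (\<lambda>a. tensor_lift (\<lambda>x y. h x * y) (\<Delta> a)) id T"
    if h: "clinear h" for h
  proof -
    have lin: "clinear (\<lambda>a. tensor_lift (\<lambda>x y. h x * y) (\<Delta> a))"
      using Vector_Spaces.linear_compose[OF linear_comult
          clinear_tensor_lift[OF cbilinear_mult_left[OF h]]] by (simp add: o_def)
    have "contract_left h (tensor_assoc (tensor_map \<Delta> id t))
        = tensor_map (\<lambda>a. tensor_lift (\<lambda>x y. h x * y) (\<Delta> a)) id t" for t
      by (induction t rule: tensor_induct)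
        (simp_all add: contract_left_assoc[OF h] tensor_map_pure linear_comult clinear_id lin
          clinear_add[OF clinear_tensor_map] clinear_scale[OF clinear_tensor_map]
          clinear_add[OF clinear_tensor_assoc] clinear_scale[OF clinear_tensor_assoc]
          clinear_add[OF clinear_contract_left[OF h]]
          clinear_scale[OF clinear_contract_left[OF h]])
    from this[of T] show ?thesis by (simp add: hex contract_left_legs[OF h])
  qed
  have "tensor_map unit_counit id T * T = tensor_map (\<lambda>a. a) id T"
    using key[OF clinear_unit_counit] by (simp add: mult_scaleC_left counit_left)
  then have "tensor_map unit_counit id T * T = T"
    using tensor_map_id[of T] by (simp add: id_def)
  then have "tensor_map unit_counit id T * (T * T') = T * T'"
    by (simp add: mult.assoc[symmetric])
  then have "tensor_map unit_counit id T = 1"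
    by (simp add: inv)
  then show ?thesis
    using key[OF linear_antipode] by (simp add: antipode_left)
qed

text \<open>The mirror image, for an element satisfying the hexagon identity of an inverse R-matrix: the
  legs appear in the order that lets the antipode act on the second factor without reversing any
  product.\<close>

lemma id_antipode_right_inverse:
  assumes hex: "tensor_map id \<Delta> T = leg12 T * leg13 T"
    and inv: "T' * T = 1"
  shows "T * tensor_map id S T = 1"
proof -
  have key: "T * tensor_map id h T = tensor_map id (\<lambda>a. tensor_lift (\<lambda>x y. x * h y) (\<Delta> a)) T"
    if h: "clinear h" for h
  proof -
    have lin: "clinear (\<lambda>a. tensor_lift (\<lambda>x y. x * h y) (\<Delta> a))"
      using Vector_Spaces.linear_compose[OF linear_comult
          clinear_tensor_lift[OF cbilinear_mult_right[OF h]]] by (simp add: o_def)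
    have "contract_right h (tensor_map id \<Delta> t)
        = tensor_map id (\<lambda>a. tensor_lift (\<lambda>x y. x * h y) (\<Delta> a)) t" for t
      by (induction t rule: tensor_induct)
        (simp_all add: contract_right_pure[OF h] tensor_map_pure linear_comult clinear_id lin
          clinear_add[OF clinear_tensor_map] clinear_scale[OF clinear_tensor_map]
          clinear_add[OF clinear_contract_right[OF h]]
          clinear_scale[OF clinear_contract_right[OF h]])
    from this[of T] show ?thesis by (simp add: hex contract_right_legs[OF h])
  qed
  have "T * tensor_map id unit_counit T = tensor_map id (\<lambda>a. a) T"
    using key[OF clinear_unit_counit] by (simp add: mult_scaleC_right counit_right)
  then have "T * tensor_map id unit_counit T = T"
    using tensor_map_id[of T] by (simp add: id_def)
  then have "T' * T * tensor_map id unit_counit T = T' * T"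
    by (simp add: mult.assoc)
  then have "tensor_map id unit_counit T = 1"
    by (simp add: inv)
  then show ?thesis
    using key[OF linear_antipode] by (simp add: antipode_right)
qed

end

context quasitriangular_hopf_algebra
begin

lemma R_inverse: "R * alg_inv R = 1" "alg_inv R * R = 1"
  using alg_inv[OF R_invertible] by simp_all

lemma id_comult_mult: "tensor_map id \<Delta> (s * t) = tensor_map id \<Delta> s * tensor_map id \<Delta> t"
  by (rule tensor_multiplicativeI[OF clinear_tensor_map[OF clinear_id(1) linear_comult]])
    (simp add: tensor_times_pure tensor_map_pure clinear_id linear_comult comult_mult)

text \<open>Inverting the hexagon identity for \<open>R\<close> reverses the order of its two factors.\<close>

lemma id_comult_R_inverse:
  "tensor_map id \<Delta> (alg_inv R) = leg12 (alg_inv R) * leg13 (alg_inv R)"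
proof -
  let ?D = "tensor_map id \<Delta>" and ?L = "leg12 (alg_inv R) * leg13 (alg_inv R)"
  have "?L * ?D R = leg12 (alg_inv R) * (leg13 (alg_inv R) * leg13 R) * leg12 R"
    by (simp add: id_comult_R mult.assoc)
  also have "\<dots> = 1"
    by (simp add: leg12_mult[symmetric] leg13_mult[symmetric] R_inverse leg_one)
  finally have left: "?L * ?D R = 1" .
  have "?D 1 = 1"
    by (simp add: one_tensor_def tensor_map_pure clinear_id linear_comult comult_one[unfolded one_tensor_def])
  then have "?D R * ?D (alg_inv R) = 1"
    by (simp add: id_comult_mult[symmetric] R_inverse)
  from left_inverse_eq_right_inverse[OF left this] show ?thesis
    by (rule sym)
qed

lemma antipode_antipode_R: "tensor_map S S R = R"
proof -
  have S_id: "tensor_map S id R = alg_inv R"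
    by (rule left_inverse_eq_right_inverse[OF
          antipode_id_left_inverse[OF comult_id_R R_inverse(1)] R_inverse(1)])
  have id_S: "tensor_map id S (alg_inv R) = R"
    by (rule left_inverse_eq_right_inverse[OF R_inverse(1)
          id_antipode_right_inverse[OF id_comult_R_inverse R_inverse(1)], symmetric])
  have "tensor_map S S t = tensor_map id S (tensor_map S id t)" for t
    by (induction t rule: tensor_induct)
      (simp_all add: tensor_map_pure clinear_id linear_antipode clinear_add[OF clinear_tensor_map]
        clinear_scale[OF clinear_tensor_map])
  then show ?thesis by (simp add: S_id id_S)
qed

end


section \<open>The action of a tensor square\<close>

lemma
  assumes U: "cbilinear actU" and V: "cbilinear actV"
  shows cbilinear_tensor_act: "cbilinear (tensor_act actU actV)"
    and tensor_act_pure_bilinear: "tensor_act actU actV (a \<otimes> b) (u \<otimes> v) = actU a u \<otimes> actV b v"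
proof -
  have linU: "clinear (actU a)" and linV: "clinear (actV a)" for a
    using U V by (simp_all add: cbilinear_def)
  have bil: "cbilinear (\<lambda>a b. tensor_map (actU a) (actV b) x)" for x
    unfolding tensor_map_def
    by (rule cbilinearI)
      (simp_all add: cbilinearD[OF U] cbilinearD[OF V] pure_tensor_bilinear
        tensor_lift_add tensor_lift_scale)
  show "cbilinear (tensor_act actU actV)"
    by (rule cbilinearI)
      (simp_all add: tensor_act_def tensor_lift_add tensor_lift_scale
        clinear_add[OF clinear_tensor_map[OF linU linV]]
        clinear_scale[OF clinear_tensor_map[OF linU linV]]
        clinear_add[OF clinear_tensor_lift[OF bil]] clinear_scale[OF clinear_tensor_lift[OF bil]])
  show "tensor_act actU actV (a \<otimes> b) (u \<otimes> v) = actU a u \<otimes> actV b v"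
    unfolding tensor_act_def
    by (subst tensor_lift_pure[OF bil]) (rule tensor_map_pure[OF linU linV])
qed

lemma tensor_act_one:
  assumes "left_module actU" "left_module actV"
  shows "tensor_act actU actV 1 x = x"
proof -
  note b = cbilinearD[OF cbilinear_tensor_act[OF assms[THEN left_module.bilinear_act]]]
  show ?thesis
    by (induction x rule: tensor_induct)
      (simp_all add: one_tensor_def tensor_act_pure assms left_module.act_one b)
qed

lemma tensor_act_mult:
  assumes "left_module actU" "left_module actV"
  shows "tensor_act actU actV (r * s) x = tensor_act actU actV r (tensor_act actU actV s x)"
proof -
  note b = cbilinearD[OF cbilinear_tensor_act[OF assms[THEN left_module.bilinear_act]]]
  show ?thesis
  proof (induction r rule: tensor_induct)
    case (pure a1 a2)
    show ?case
    proof (induction s rule: tensor_induct)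
      case (pure b1 b2)
      show ?case
        by (induction x rule: tensor_induct)
          (simp_all add: tensor_times_pure tensor_act_pure assms left_module.act_mult b)
    qed (simp_all add: b distrib_left mult_scaleC_right)
  qed (simp_all add: b distrib_right mult_scaleC_left)
qed

lemma tensor_flip_act:
  assumes "cbilinear actU" "cbilinear actV"
  shows "tensor_flip (tensor_act actU actV r x) = tensor_act actV actU (tensor_flip r) (tensor_flip x)"
proof -
  note b = cbilinearD[OF cbilinear_tensor_act[OF assms]]
    cbilinearD[OF cbilinear_tensor_act[OF assms(2,1)]]
    clinear_add[OF clinear_tensor_flip] clinear_scale[OF clinear_tensor_flip]
  show ?thesis
  proof (induction r rule: tensor_induct)
    case (pure a1 a2)
    show ?case
      by (induction x rule: tensor_induct) (simp_all add: tensor_act_pure_bilinear assms b)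
  qed (simp_all add: b)
qed

lemma clinear_braiding:
  assumes "cbilinear actU" "cbilinear actV"
  shows "clinear (braiding R actU actV)"
  unfolding braiding_def
  using cbilinear_tensor_act[OF assms]
  by (intro Vector_Spaces.linear_compose[OF _ clinear_tensor_flip]) (simp add: cbilinear_def)

lemma
  assumes R: "alg_invertible R" and mods: "left_module actU" "left_module actV"
  shows bij_braiding: "bij (braiding R actU actV)"
    and inv_braiding:
      "inv (braiding R actU actV) = (\<lambda>x. tensor_act actU actV (alg_inv R) (tensor_flip x))"
proof -
  let ?g = "\<lambda>x. tensor_act actU actV (alg_inv R) (tensor_flip x)"
  have gf: "?g (braiding R actU actV x) = x" and fg: "braiding R actU actV (?g y) = y" for x y
    by (simp_all add: braiding_def tensor_act_mult[OF mods, symmetric] alg_inv[OF R]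
        tensor_act_one[OF mods])
  show "bij (braiding R actU actV)"
    by (rule o_bij[of ?g]) (simp_all add: fun_eq_iff gf fg)
  show "inv (braiding R actU actV) = ?g"
    by (rule inv_equality) (rule gf, rule fg)
qed


section \<open>The conjugate braiding\<close>

lemma clinear_double_conj: "clinear double_conj"
  by (rule clinearI) (simp_all add: double_conj_def unbar_add unbar_scaleC)

lemma inv_double_conj [simp]: "inv double_conj v = Bar (Bar v)"
  by (rule inv_f_eq[OF bij_is_inj[OF bij_double_conj]]) (simp add: double_conj_def)

lemma clinear_inv_double_conj: "clinear (inv double_conj)"
  by (rule clinear_inv[OF clinear_double_conj bij_double_conj])

lemma clinear_map_conjugate:
  assumes "clinear f"
  shows "clinear (map_conjugate f)"
proof (rule clinearI)
  show "map_conjugate f (x + y) = map_conjugate f x + map_conjugate f y" for x y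
    by (cases x; cases y) (simp add: Bar_add[symmetric] clinear_add[OF assms])
  show "map_conjugate f (c *\<^sub>C x) = c *\<^sub>C map_conjugate f x" for c x
    by (cases x) (simp add: scaleC_conjugate_def clinear_scale[OF assms])
qed

lemma clinear_conj_braiding:
  assumes "clinear \<psi>"
  shows "clinear (conj_braiding \<psi>)"
  unfolding conj_braiding_def xi_def
  by (intro Vector_Spaces.linear_compose[of _ scaleC] clinear_tensor_map clinear_double_conj
      clinear_inv_double_conj clinear_conj_flip clinear_map_conjugate assms
      clinear_inv[OF clinear_conj_flip bij_conj_flip])

text \<open>Removing the bars from a tensor reverses its factors, and is antilinear.\<close>

definition unconj_flip ::
    "('v::complex_vector conjugate, 'w::complex_vector conjugate) tensor \<Rightarrow> ('w, 'v) tensor"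
  where "unconj_flip t = tensor_map double_conj double_conj (conj_flip (Bar t))"

lemma unconj_flip_pure [simp]: "unconj_flip (Bar v \<otimes> Bar w) = w \<otimes> v"
  by (simp add: unconj_flip_def tensor_map_pure clinear_double_conj double_conj_def)

lemma unconj_flip_add: "unconj_flip (s + t) = unconj_flip s + unconj_flip t"
  by (simp add: unconj_flip_def Bar_add clinear_add[OF clinear_conj_flip]
      clinear_add[OF clinear_tensor_map[OF clinear_double_conj clinear_double_conj]])

lemma unconj_flip_scaleC: "unconj_flip (c *\<^sub>C t) = cnj c *\<^sub>C unconj_flip t"
  by (simp add: unconj_flip_def Bar_scaleC clinear_scale[OF clinear_conj_flip]
      clinear_scale[OF clinear_tensor_map[OF clinear_double_conj clinear_double_conj]])

lemma conj_braiding_pure: "conj_braiding \<psi> (x \<otimes> y) = unconj_flip (\<psi> (Bar y \<otimes> Bar x))"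
proof -
  have "inv conj_flip (Bar (Bar x) \<otimes> Bar (Bar y)) = Bar (Bar y \<otimes> Bar x)"
    by (rule inv_f_eq[OF bij_is_inj[OF bij_conj_flip]]) simp
  then show ?thesis
    by (simp add: conj_braiding_def xi_def unconj_flip_def tensor_map_pure
        clinear_inv_double_conj)
qed

lemma cbilinear_conj_act:
  assumes act: "cbilinear act" and S: "clinear S" and star: "antilinear star"
  shows "cbilinear (conj_act S star act)"
  by (rule cbilinearI)
    (use star in \<open>simp_all add: conj_act_def antilinear_def cbilinearD[OF act] clinear_add[OF S]
      clinear_scale[OF S] Bar_add Bar_scaleC unbar_add unbar_scaleC\<close>)

text \<open>For \<open>r = a \<otimes> b\<close>, applying the braiding of \<open>r\<close> to \<open>Bar y \<otimes> Bar x\<close> yields the conjugate of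
  \<open>(S b)\<^sup>* x\<close> tensored with the conjugate of \<open>(S a)\<^sup>* y\<close>, and removing the bars swaps the factors.
  Both sides are antilinear in \<open>r\<close>, so pure tensors suffice.\<close>

lemma conj_braiding_of_braiding:
  assumes U: "cbilinear actU" and V: "cbilinear actV"
    and S: "clinear S" and star: "antilinear star"
  shows "conj_braiding (braiding r (conj_act S star actV) (conj_act S star actU))
    = braiding (tensor_flip (tensor_star star (tensor_map S S r))) actU actV"
proof
  fix t
  note cU = cbilinear_conj_act[OF U S star] and cV = cbilinear_conj_act[OF V S star]
  have "antilinear (tensor_star star)"
    unfolding tensor_star_def
    by (rule antilinear_antilinear_lift)
      (use star in \<open>simp_all add: antilinear_def pure_tensor_bilinear\<close>)
  note lin = this[unfolded antilinear_def, THEN conjunct1, rule_format]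
    this[unfolded antilinear_def, THEN conjunct2, rule_format]
    clinear_add[OF clinear_tensor_flip] clinear_scale[OF clinear_tensor_flip]
    clinear_add[OF clinear_tensor_map[OF S S]] clinear_scale[OF clinear_tensor_map[OF S S]]
    cbilinearD[OF cbilinear_tensor_act[OF cV cU]] cbilinearD[OF cbilinear_tensor_act[OF U V]]
    unconj_flip_add unconj_flip_scaleC
  show "conj_braiding (braiding r (conj_act S star actV) (conj_act S star actU)) t
      = braiding (tensor_flip (tensor_star star (tensor_map S S r))) actU actV t"
  proof (rule tensor_ext[OF clinear_conj_braiding[OF clinear_braiding[OF cV cU]]
        clinear_braiding[OF U V]])
    fix x y
    show "conj_braiding (braiding r (conj_act S star actV) (conj_act S star actU)) (x \<otimes> y)
        = braiding (tensor_flip (tensor_star star (tensor_map S S r))) actU actV (x \<otimes> y)"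
      unfolding conj_braiding_pure braiding_def o_def
    proof (induction r rule: tensor_induct)
      case (pure a b)
      show ?case
        by (simp add: tensor_act_pure_bilinear[OF cV cU] tensor_act_pure_bilinear[OF U V]
            tensor_map_pure S tensor_star_pure[OF star], simp add: conj_act_def)
    qed (simp_all add: lin)
  qed
qed

theorem proposition9p11:
  fixes \<Delta> :: "'h::complex_algebra_1 \<Rightarrow> ('h, 'h) tensor"
    and \<epsilon> :: "'h \<Rightarrow> complex"
    and S star :: "'h \<Rightarrow> 'h"
    and R :: "('h, 'h) tensor"
    and actU :: "'h \<Rightarrow> 'u::complex_vector \<Rightarrow> 'u"
    and actV :: "'h \<Rightarrow> 'v::complex_vector \<Rightarrow> 'v"
  assumes "quasitriangular_hopf_star_algebra \<Delta> \<epsilon> S star R"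
    and "left_module actU" and "left_module actV"
  shows "(real_R_matrix star R \<longrightarrow>
            conj_braiding (braiding R (conj_act S star actV) (conj_act S star actU))
              = braiding R actU actV)
       \<and> (inverse_real_R_matrix star R \<longrightarrow>
            bij (braiding R actV actU) \<and>
            conj_braiding (braiding R (conj_act S star actV) (conj_act S star actU))
              = inv (braiding R actV actU))"
proof -
  interpret quasitriangular_hopf_star_algebra \<Delta> \<epsilon> S star R by (rule assms(1))
  note U = left_module.bilinear_act[OF assms(2)] and V = left_module.bilinear_act[OF assms(3)]
  have conj: "conj_braiding (braiding R (conj_act S star actV) (conj_act S star actU))
      = braiding (tensor_flip (tensor_star star R)) actU actV"
    using conj_braiding_of_braiding[OF U V linear_antipode antilinear_star, of R]
    by (simp add: antipode_antipode_R)
  have "braiding (tensor_flip (alg_inv R)) actU actV = inv (braiding R actV actU)"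
    unfolding inv_braiding[OF R_invertible assms(3,2)]
    by (simp add: fun_eq_iff braiding_def tensor_flip_act[OF U V])
  then show ?thesis
    using bij_braiding[OF R_invertible assms(3,2)]
    by (simp add: conj real_R_matrix_def inverse_real_R_matrix_def)
qed

end
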